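(* Let $m \equiv 0 \pmod{4}$ be a positive integer, and let $e$ be an integer with $2 \leq e \leq m/2$ and $\gcd(m,e)=2$. Let $\alpha$ be a generator of $\mathbb{F}_{2^m}^*$, let $\mathcal{C}_E$ be the binary cyclic code of length $2^m-1$ with generator polynomial $\operatorname{lcm}\big(\mathbb{M}_{\alpha}(x),\mathbb{M}_{\alpha^{1+2^e}}(x)\big)$, and let $\overline{\mathcal{C}_E}$ be its extended code, with coordinates indexed by $V=\{0,1,\dots,2^m-1\}$. Then the supports of the codewords of Hamming weight $4$ in $\overline{\mathcal{C}_E}$ form a $2$-$(2^m,4,1)$ design on $V$, i.e., a Steiner system $S(2,4,2^m)$.
   Context: $\mathbb{M}_{\beta}(x)$ denotes the minimal polynomial of $\beta\in\mathbb{F}_{2^m}$ over $\mathbb{F}_2$. A binary cyclic code of length $n$ with generator polynomial $g(x)$ is the ideal generated by $g(x)$ in $\mathbb{F}_2[x]/(x^n-1)$, identified with vectors in $\mathbb{F}_2^n$. The extended code is obtained by appending an overall parity-check coordinate (sum of all coordinates) to each codeword. The support of a codeword is the set of coordinates where it is nonzero. A $2$-$(v,k,\lambda)$ design is a pair $(V,\mathcal{B})$ with $|V|=v$ and $\mathcal{B}$ a set of $k$-subsets of $V$ such that every $2$-subset of $V$ is contained in exactly $\lambda$ members of $\mathcal{B}$; a $2$-$(v,k,1)$ design is a Steiner system $S(2,k,v)$. *)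

theory Defs
  imports "HOL-Library.Z2" "HOL-Library.Cardinality" "HOL-Computational_Algebra.Computational_Algebra"
    "HOL-Computational_Algebra.Field_as_Ring"
begin

text \<open>
  The class instances that make \<^typ>\<open>bit poly\<close> a ring with the library's \<^const>\<open>lcm\<close>,
  in the same way as for the fields treated in \<open>Field_as_Ring\<close>.
\<close>

instantiation bit ::
  "{unique_euclidean_ring, normalization_euclidean_semiring, normalization_semidom_multiplicative}"
begin

definition [simp]: "normalize_bit = (normalize_field :: bit \<Rightarrow> _)"
definition [simp]: "unit_factor_bit = (unit_factor_field :: bit \<Rightarrow> _)"
definition [simp]: "euclidean_size_bit = (euclidean_size_field :: bit \<Rightarrow> _)"
definition [simp]: "division_segment (x :: bit) = 1"

instance
  by standard (auto simp: dvd_field_iff)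

end

instantiation bit :: euclidean_ring_gcd
begin

definition gcd_bit :: "bit \<Rightarrow> bit \<Rightarrow> bit" where
  "gcd_bit = Euclidean_Algorithm.gcd"
definition lcm_bit :: "bit \<Rightarrow> bit \<Rightarrow> bit" where
  "lcm_bit = Euclidean_Algorithm.lcm"
definition Gcd_bit :: "bit set \<Rightarrow> bit" where
  "Gcd_bit = Euclidean_Algorithm.Gcd"
definition Lcm_bit :: "bit set \<Rightarrow> bit" where
  "Lcm_bit = Euclidean_Algorithm.Lcm"

instance
  by standard (simp_all add: gcd_bit_def lcm_bit_def Gcd_bit_def Lcm_bit_def)

end

instance bit :: field_gcd ..

text \<open>
  Evaluation of a polynomial over the two-element field at a point of an extension field.
  The map \<^term>\<open>of_bit\<close> sends 0 to 0 and 1 to 1; it is a field embedding exactly when the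
  target has characteristic 2.
\<close>

definition eval_bit_poly :: "bit poly \<Rightarrow> 'a::field \<Rightarrow> 'a" where
  "eval_bit_poly p x = poly (map_poly of_bit p) x"

definition min_poly_bit :: "'a::field \<Rightarrow> bit poly" where
  "min_poly_bit \<beta> = (THE p. lead_coeff p = 1 \<and> eval_bit_poly p \<beta> = 0 \<and>
     (\<forall>q. q \<noteq> 0 \<and> eval_bit_poly q \<beta> = 0 \<longrightarrow> degree p \<le> degree q))"

text \<open>
  The ideal generated by \<open>g\<close> in the polynomial ring modulo \<open>x\<^sup>n - 1\<close>: residue classes are
  represented by their remainders, and the remainder \<open>c\<^sub>0 + c\<^sub>1 x + \<dots>\<close> is identified with
  the list of its first \<open>n\<close> coefficients.
\<close>

definition cyclic_code :: "nat \<Rightarrow> bit poly \<Rightarrow> bit list set" where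
  "cyclic_code n g = {map (coeff ((a * g) mod (monom 1 n - 1))) [0..<n] | a. True}"

definition extended_code :: "bit list set \<Rightarrow> bit list set" where
  "extended_code C = {c @ [sum_list c] | c. c \<in> C}"

definition support :: "bit list \<Rightarrow> nat set" where
  "support c = {i. i < length c \<and> c ! i \<noteq> 0}"

definition hamming_weight :: "bit list \<Rightarrow> nat" where
  "hamming_weight c = card (support c)"

text \<open>A \<open>2\<close>-\<open>(v,k,1)\<close> design is a Steiner system \<open>S(2,k,v)\<close>.\<close>

definition two_design :: "'b set \<Rightarrow> 'b set set \<Rightarrow> nat \<Rightarrow> nat \<Rightarrow> nat \<Rightarrow> bool" where
  "two_design V \<B> v k l \<longleftrightarrow>
     finite V \<and> card V = v \<and>
     (\<forall>B\<in>\<B>. B \<subseteq> V \<and> card B = k) \<and>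
     (\<forall>P. P \<subseteq> V \<and> card P = 2 \<longrightarrow> card {B \<in> \<B>. P \<subseteq> B} = l)"

end

theory Submission
  imports Defs
begin

text \<open>
  Identify coordinate \<open>i < 2\<^sup>m - 1\<close> with the field element \<open>\<alpha>\<^sup>i\<close> and the parity coordinate with \<open>0\<close>.
  With \<open>q = 2\<^sup>e\<close>, the blocks become the 4-subsets of the field whose elements sum to \<open>0\<close> and
  whose \<open>(1 + q)\<close>-th powers sum to \<open>0\<close>. If \<open>{x, y, z, w}\<close> is such a set and \<open>u = x + y\<close>, then
  additivity of \<open>q\<close>-th powers reduces the two equations to \<open>s\<^sup>q = s\<close> for \<open>s = (x + z) / u\<close>, i.e. to \<open>s\<close>
  lying in the subfield of order \<open>2\<^bsup>gcd m e\<^esup> = 4\<close>. The two elements of that subfield other than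
  \<open>0\<close> and \<open>1\<close> differ by \<open>1\<close>, so they merely exchange \<open>z\<close> and \<open>w\<close>, and the block is unique.
\<close>

section \<open>Fields of characteristic two\<close>

lemma char2_add_self:
  assumes "(2::'a::field) = 0"
  shows "x + x = (0::'a)"
  by (metis assms mult_2 mult_zero_left)

lemma char2_uminus:
  assumes "(2::'a::field) = 0"
  shows "- x = (x::'a)"
  using char2_add_self[OF assms, of x] by (simp add: minus_unique)

lemma char2_add_eq_0_iff:
  assumes "(2::'a::field) = 0"
  shows "x + y = 0 \<longleftrightarrow> x = (y::'a)"
  by (metis assms char2_uminus eq_neg_iff_add_eq_0)

lemma char2_power_add:
  assumes "(2::'a::field) = 0"
  shows "(x + y) ^ 2 ^ k = x ^ 2 ^ k + (y::'a) ^ 2 ^ k"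
proof (induction k)
  case (Suc k)
  have "(x + y) ^ 2 ^ Suc k = ((x + y) ^ 2 ^ k)\<^sup>2"
    by (simp add: power_mult mult.commute flip: power_mult)
  also have "\<dots> = (x ^ 2 ^ k)\<^sup>2 + (y ^ 2 ^ k)\<^sup>2"
    by (simp add: Suc power2_sum assms)
  also have "\<dots> = x ^ 2 ^ Suc k + y ^ 2 ^ Suc k"
    by (simp add: power_mult mult.commute flip: power_mult)
  finally show ?case .
qed simp

text \<open>Every element is fixed by the power \<open>CARD('a)\<close>. This exponent is even
  because \<open>m > 0\<close>, so applying it to -1 gives -1 = 1.\<close>

lemma char2_of_card:
  assumes "CARD('a::finite_field) = 2 ^ m" and "m > 0"
  shows "(2::'a) = 0"
proof -
  have "(-1::'a) = (-1) ^ CARD('a)"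
    by (rule finite_field_power_card_eq_same[symmetric])
  also have "\<dots> = 1"
    using assms by simp
  finally show ?thesis
    by (metis add.right_inverse one_add_one)
qed

lemma power_2_power_mult_fixed:
  fixes x :: "'a::monoid_mult"
  assumes "x ^ 2 ^ k = x"
  shows "x ^ 2 ^ (a * k) = x"
  by (induction a) (simp_all add: power_add power_mult assms)

text \<open>The exponents k with \<open>x ^ 2 ^ k = x\<close> are closed under multiples, and a
  Bezout relation without negative terms lets the multiple of \<open>m\<close> be stripped off,
  leaving the gcd.\<close>

lemma power_2_power_gcd_fixed:
  fixes x :: "'a::monoid_mult"
  assumes "x ^ 2 ^ m = x" and "x ^ 2 ^ e = x" and "e \<noteq> 0"
  shows "x ^ 2 ^ gcd m e = x"
proof -
  obtain a b where ab: "e * a = m * b + gcd m e"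
    using bezout_nat[OF assms(3), of m] by (auto simp: gcd.commute)
  have "x = x ^ 2 ^ (m * b + gcd m e)"
    using power_2_power_mult_fixed[OF assms(2), of a] by (metis ab mult.commute)
  also have "\<dots> = (x ^ 2 ^ (b * m)) ^ 2 ^ gcd m e"
    by (simp add: power_add mult.commute flip: power_mult)
  also have "\<dots> = x ^ 2 ^ gcd m e"
    by (simp add: power_2_power_mult_fixed assms)
  finally show ?thesis by simp
qed

section \<open>Minimal polynomials and cyclic codes\<close>

lemma eval_bit_poly_0 [simp]: "eval_bit_poly 0 x = 0"
  by (simp add: eval_bit_poly_def)

lemma eval_bit_poly_pCons [simp]:
  "eval_bit_poly (pCons a p) x = of_bit a + x * eval_bit_poly p x"
  by (simp add: eval_bit_poly_def map_poly_pCons)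

lemma eval_bit_poly_monom: "eval_bit_poly (monom 1 n) x = x ^ n"
  by (simp add: eval_bit_poly_def map_poly_monom poly_monom)

text \<open>Characteristic 2 is what makes \<open>of_bit\<close> additive: the relation 1 + 1 = 0 of
  \<open>bit\<close> has to hold in the target field too.\<close>

lemma eval_bit_poly_add:
  assumes "(2::'a::field) = 0"
  shows "eval_bit_poly (p + q) (x::'a) = eval_bit_poly p x + eval_bit_poly q x"
  by (induction p q rule: poly_induct2)
     (auto simp: assms algebra_simps)

lemma eval_bit_poly_diff:
  assumes "(2::'a::field) = 0"
  shows "eval_bit_poly (p - q) (x::'a) = eval_bit_poly p x - eval_bit_poly q x"
  using eval_bit_poly_add[OF assms, of "p - q" q x] by simp

lemma eval_bit_poly_mult:
  assumes "(2::'a::field) = 0"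
  shows "eval_bit_poly (p * q) (x::'a) = eval_bit_poly p x * eval_bit_poly q x"
proof (induction p)
  case (pCons a p)
  have "eval_bit_poly (smult a q) x = of_bit a * eval_bit_poly q x"
    by (cases a) auto
  with pCons show ?case
    by (simp add: eval_bit_poly_add[OF assms] algebra_simps)
qed simp

text \<open>Coefficients are only 0 or 1, so evaluating a word at a point depends on its support
  alone. This is the bridge from code membership to power sums over blocks.\<close>

lemma eval_bit_poly_Poly:
  "eval_bit_poly (Poly c) x = (\<Sum>i\<in>support c. x ^ i)"
proof -
  have "eval_bit_poly (Poly c) x = (\<Sum>i<length c. of_bit (c ! i) * x ^ i)"
    by (induction c)
       (simp_all add: sum.lessThan_Suc_shift sum_distrib_left mult.left_commute
          del: sum.lessThan_Suc sum_of_bool_mult_eq sum_mult_of_bool_eq)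
  also have "\<dots> = (\<Sum>i<length c. if c ! i \<noteq> 0 then x ^ i else 0)"
    by (rule sum.cong) auto
  also have "\<dots> = (\<Sum>i\<in>support c. x ^ i)"
    unfolding support_def by (subst sum.inter_filter [symmetric]) simp_all
  finally show ?thesis .
qed

text \<open>The annihilating polynomial \<open>f\<close> guarantees one of least degree, so the
  description in \<open>min_poly_bit\<close> has a solution. Uniqueness comes from subtracting two
  candidates, divisibility from division with remainder.\<close>

lemma min_poly_bit_dvd_iff:
  assumes two: "(2::'a::field) = 0"
    and alg: "f \<noteq> 0" "eval_bit_poly f (\<beta>::'a) = 0"
  shows "min_poly_bit \<beta> dvd p \<longleftrightarrow> eval_bit_poly p \<beta> = 0"
proof -
  let ?P = "\<lambda>p. lead_coeff p = 1 \<and> eval_bit_poly p \<beta> = 0 \<and>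
     (\<forall>q. q \<noteq> 0 \<and> eval_bit_poly q \<beta> = 0 \<longrightarrow> degree p \<le> degree q)"
  obtain g where g: "g \<noteq> 0" "eval_bit_poly g \<beta> = 0"
    and least: "\<And>q. q \<noteq> 0 \<Longrightarrow> eval_bit_poly q \<beta> = 0 \<Longrightarrow> degree g \<le> degree q"
    using ex_has_least_nat[of "\<lambda>p. p \<noteq> 0 \<and> eval_bit_poly p \<beta> = 0" f degree] alg by blast
  have Pg: "?P g"
    using g least bit_not_zero_iff[of "lead_coeff g"] by (simp del: bit_not_zero_iff bit_not_one_iff)
  have "h = g" if h: "?P h" for h
  proof (rule ccontr)
    assume "h \<noteq> g"
    then have ne: "h - g \<noteq> 0" by simp
    have "h \<noteq> 0" using h by auto
    then have deg: "degree h = degree g"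
      using h Pg g(1) by (metis le_antisym)
    have "eval_bit_poly (h - g) \<beta> = 0"
      using h Pg by (simp add: eval_bit_poly_diff[OF two])
    then have "degree g \<le> degree (h - g)"
      using least ne by blast
    moreover have "degree (h - g) \<le> degree g"
      using degree_diff_le[of h "degree g" g] deg by simp
    \<comment> \<open>Both polynomials are monic of the same degree, so the top terms cancel and the
      difference would violate minimality.\<close>
    moreover have "coeff (h - g) (degree g) = 0"
      using h Pg deg by simp
    ultimately show False
      using ne by (metis le_antisym leading_coeff_0_iff)
  qed
  then have min: "min_poly_bit \<beta> = g"
    unfolding min_poly_bit_def using Pg by (intro the_equality) blast+
  have "eval_bit_poly (p mod g) \<beta> = eval_bit_poly p \<beta>"
    using g by (simp add: eval_bit_poly_diff[OF two] eval_bit_poly_mult[OF two]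
        flip: minus_div_mult_eq_mod)
  moreover have "p mod g = 0 \<longleftrightarrow> eval_bit_poly (p mod g) \<beta> = 0"
    using least[of "p mod g"] degree_mod_less'[OF g(1), of p] by fastforce
  ultimately show ?thesis
    unfolding min dvd_eq_mod_eq_0 by metis
qed

lemma degree_monom_minus_1:
  assumes "n > 0"
  shows "degree (monom 1 n - 1 :: 'a::comm_ring_1 poly) = n"
proof -
  have "degree (monom 1 n + (- 1) :: 'a poly) = n"
    using assms by (subst degree_add_eq_left) (simp_all add: degree_monom_eq)
  then show ?thesis by simp
qed

lemma Poly_map_coeff:
  assumes "\<And>i. i \<ge> n \<Longrightarrow> coeff p i = 0"
  shows "Poly (map (coeff p) [0..<n]) = p"
  using assms by (intro poly_eqI) (auto simp: nth_default_def)

text \<open>As \<open>g\<close> divides the modulus, reduction preserves divisibility by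
  \<open>g\<close>. Conversely a word of length \<open>n\<close> has degree below \<open>n\<close>
  and is its own remainder.\<close>

lemma mem_cyclic_code_iff:
  assumes "n > 0" and g: "g dvd monom 1 n - 1"
  shows "c \<in> cyclic_code n g \<longleftrightarrow> length c = n \<and> g dvd Poly c"
proof -
  let ?M = "monom 1 n - 1 :: bit poly"
  have deg: "degree ?M = n"
    by (rule degree_monom_minus_1[OF assms(1)])
  then have M0: "?M \<noteq> 0"
    using assms(1) by auto
  show ?thesis
  proof
    assume "c \<in> cyclic_code n g"
    then obtain a where c: "c = map (coeff ((a * g) mod ?M)) [0..<n]"
      unfolding cyclic_code_def by blast
    have "coeff ((a * g) mod ?M) i = 0" if "i \<ge> n" for i
      using degree_mod_less[OF M0, of "a * g"] that deg by (auto intro: coeff_eq_0)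
    then have "Poly c = (a * g) mod ?M"
      unfolding c by (rule Poly_map_coeff)
    then show "length c = n \<and> g dvd Poly c"
      using g by (simp add: c dvd_mod)
  next
    assume A: "length c = n \<and> g dvd Poly c"
    then obtain a where a: "Poly c = a * g"
      by (metis dvdE mult.commute)
    have "degree (Poly c) \<le> n - 1"
      using A by (intro degree_le) (auto simp: nth_default_def)
    then have "degree (Poly c) < n"
      using assms(1) by linarith
    then have "(a * g) mod ?M = Poly c"
      using deg by (simp add: a mod_poly_less)
    moreover have "c = map (coeff (Poly c)) [0..<n]"
      using A by (intro nth_equalityI) (auto simp: nth_default_def)
    ultimately show "c \<in> cyclic_code n g"
      unfolding cyclic_code_def by (metis (mono_tags, lifting) mem_Collect_eq)
  qed
qed

section \<open>Supports of extended codewords of weight 4\<close>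

lemma support_append_single:
  "support (c @ [s]) = support c \<union> (if s = 0 then {} else {length c})"
  by (auto simp: support_def nth_append less_Suc_eq)

lemma support_subset: "support c \<subseteq> {..<length c}"
  by (auto simp: support_def)

text \<open>Since \<open>\<alpha> ^ n = 1\<close>, the generator divides
  \<open>monom 1 n - 1\<close>, and membership means vanishing at \<open>\<alpha>\<close> and
  \<open>\<alpha> ^ k\<close>, that is, two power sums over the support. The parity coordinate
  \<open>n\<close> has \<open>pt n = 0\<close>, and \<open>k > 0\<close> keeps its contribution to
  the second sum at zero.\<close>

lemma weight_4_supports_extended_cyclic_code:
  fixes \<alpha> :: "'a::field"
  assumes two: "(2::'a) = 0" and n: "n > 0" and ord: "\<alpha> ^ n = 1" and "k > 0"
  defines "pt \<equiv> \<lambda>i. if i < n then \<alpha> ^ i else 0"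
  shows "{support c | c. c \<in> extended_code (cyclic_code n
            (lcm (min_poly_bit \<alpha>) (min_poly_bit (\<alpha> ^ k)))) \<and> hamming_weight c = 4} =
         {B. B \<subseteq> {..n} \<and> card B = 4 \<and> (\<Sum>i\<in>B. pt i) = 0 \<and> (\<Sum>i\<in>B. pt i ^ k) = 0}"
    (is "?L = ?R")
proof -
  let ?M = "monom 1 n - 1 :: bit poly"
  let ?g = "lcm (min_poly_bit \<alpha>) (min_poly_bit (\<alpha> ^ k))"
  have M0: "?M \<noteq> 0"
    using degree_monom_minus_1[OF n, where 'a = bit] n by force
  have ev: "eval_bit_poly ?M \<alpha> = 0" "eval_bit_poly ?M (\<alpha> ^ k) = 0"
  proof -
    have "eval_bit_poly 1 x = (1::'a)" for x
      by (simp add: one_pCons)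
    then show "eval_bit_poly ?M \<alpha> = 0" "eval_bit_poly ?M (\<alpha> ^ k) = 0"
      using ord by (simp_all add: eval_bit_poly_diff[OF two] eval_bit_poly_monom)
        (metis power_commutes power_mult power_one mult.commute)
  qed
  have g_dvd: "?g dvd p \<longleftrightarrow> eval_bit_poly p \<alpha> = 0 \<and> eval_bit_poly p (\<alpha> ^ k) = 0" for p
    using min_poly_bit_dvd_iff[OF two M0 ev(1), of p] min_poly_bit_dvd_iff[OF two M0 ev(2), of p]
    by simp
  have code: "c \<in> cyclic_code n ?g \<longleftrightarrow> length c = n \<and>
      (\<Sum>i\<in>support c. pt i) = 0 \<and> (\<Sum>i\<in>support c. pt i ^ k) = 0" for c
  proof -
    have "(\<Sum>i\<in>support c. pt i) = (\<Sum>i\<in>support c. \<alpha> ^ i)"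
         "(\<Sum>i\<in>support c. pt i ^ k) = (\<Sum>i\<in>support c. (\<alpha> ^ k) ^ i)" if "length c = n"
      using that by (auto intro!: sum.cong simp: pt_def support_def mult.commute simp flip: power_mult)
    moreover have "?g dvd ?M"
      using ev g_dvd by blast
    ultimately show ?thesis
      using mem_cyclic_code_iff[OF n, of ?g c] g_dvd[of "Poly c"]
      unfolding eval_bit_poly_Poly by metis
  qed
  have ext: "(\<Sum>i\<in>support (c @ [s]). f (pt i)) = (\<Sum>i\<in>support c. f (pt i))"
    if "length c = n" and "f 0 = 0" for c s and f :: "'a \<Rightarrow> 'a"
  proof -
    have "finite (support c)" "n \<notin> support c"
      using that(1) by (auto simp: support_def)
    then show ?thesis
      using that by (simp add: support_append_single pt_def)
  qed
  show ?thesis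
  proof (intro equalityI subsetI)
    fix B assume "B \<in> ?L"
    then obtain c where c: "c \<in> cyclic_code n ?g" "B = support (c @ [sum_list c])" "card B = 4"
      unfolding extended_code_def hamming_weight_def by blast
    have "length c = n" using c(1) code by blast
    then show "B \<in> ?R"
      using c ext[of c "\<lambda>x. x" "sum_list c"] ext[of c "\<lambda>x. x ^ k" "sum_list c"] code[of c] assms(4)
        support_subset[of "c @ [sum_list c]"]
      by (auto simp: less_Suc_eq_le)
  next
    fix B assume B: "B \<in> ?R"
    \<comment> \<open>The candidate word is the indicator of \<open>B\<close> without coordinate
      \<open>n\<close>. What remains is that its parity bit restores \<open>n\<close> exactly when
      \<open>n \<in> B\<close>: the count left over is 3 or 4, because \<open>B\<close> has even
      size.\<close>
    define c :: "bit list" where "c = map (\<lambda>i. of_bool (i \<in> B)) [0..<n]"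
    have len: "length c = n" by (simp add: c_def)
    have supp: "support c = B \<inter> {..<n}"
      by (auto simp: support_def c_def)
    have "finite B" using B by (auto intro: finite_subset)
    have "sum_list c = (\<Sum>i<n. of_bool (i \<in> B))"
      unfolding c_def by (simp add: interv_sum_list_conv_sum_set_nat atLeast0LessThan)
    also have "\<dots> = of_nat (card (B \<inter> {..<n}))"
      by (simp add: sum_of_bool_eq Int_commute Int_def conj_commute)
    also have "\<dots> = of_bool (n \<in> B)"
    proof (cases "n \<in> B")
      case True
      then have "B \<inter> {..<n} = B - {n}" using B by auto
      then have "card (B \<inter> {..<n}) = 3" using B True \<open>finite B\<close> by simp
      then show ?thesis using True by simp
    next
      case False
      then have "B \<inter> {..<n} = B" using B by (auto simp: order.strict_iff_order)
      then have "card (B \<inter> {..<n}) = 4" using B by simp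
      then show ?thesis using False by simp
    qed
    finally have "support (c @ [sum_list c]) = B"
      using B by (auto simp: support_append_single supp len order.strict_iff_order)
    moreover from this have "c \<in> cyclic_code n ?g"
      using B ext[of c "\<lambda>x. x" "sum_list c"] ext[of c "\<lambda>x. x ^ k" "sum_list c"] assms(4) len
      by (simp add: code)
    ultimately show "B \<in> ?L"
      using B unfolding extended_code_def hamming_weight_def by blast
  qed
qed

section \<open>The blocks through two points\<close>

text \<open>Substituting w = x + y + z and expanding, the diagonal terms double and vanish. The
  cross terms regroup into an equation in the differences x + z and x + y.\<close>

lemma quadruple_sums_eq_0_iff:
  fixes x y z w :: "'a::field"
  assumes two: "(2::'a) = 0"
  shows "x + y + z + w = 0 \<and> x ^ (1 + 2 ^ e) + y ^ (1 + 2 ^ e) + z ^ (1 + 2 ^ e) + w ^ (1 + 2 ^ e) = 0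
    \<longleftrightarrow> w = x + y + z \<and> (x + z) ^ 2 ^ e * (x + y) = (x + z) * (x + y) ^ 2 ^ e"
proof -
  have w: "x + y + z + w = 0 \<longleftrightarrow> w = x + y + z"
    by (metis char2_add_eq_0_iff[OF two])
  define X Y Z where "X = x ^ 2 ^ e" and "Y = y ^ 2 ^ e" and "Z = z ^ 2 ^ e"
  \<comment> \<open>This identity holds in any commutative ring; everything that dies in
    characteristic 2 and is not absorbed into the two products is collected in the last
    summand.\<close>
  have "x * X + y * Y + z * Z + (x + y + z) * (X + Y + Z) =
      (X + Z) * (x + y) + (x + z) * (X + Y) + 2 * (y * Y + z * Z)"
    by (simp add: algebra_simps)
  then have "x * X + y * Y + z * Z + (x + y + z) * (X + Y + Z) = 0
      \<longleftrightarrow> (X + Z) * (x + y) = (x + z) * (X + Y)"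
    by (simp add: two char2_add_eq_0_iff[OF two])
  then show ?thesis
    by (auto simp: w char2_power_add[OF two] X_def Y_def Z_def)
qed

text \<open>The block is the image of {0, 1, \<omega>, \<omega> + 1} under t -> x + t(x + y): the
  affine line through \<open>x\<close> and \<open>y\<close> over the subfield of fixed
  points.\<close>

lemma unique_block:
  fixes x y \<omega> :: "'a::field"
  assumes two: "(2::'a) = 0" and xy: "x \<noteq> y"
    and fixed: "\<And>s::'a. s ^ 2 ^ e = s \<longleftrightarrow> s \<in> {0, 1, \<omega>, \<omega> + 1}"
    and \<omega>: "\<omega> \<noteq> 0" "\<omega> \<noteq> 1"
  shows "card S = 4 \<and> {x, y} \<subseteq> S \<and> (\<Sum>z\<in>S. z) = 0 \<and> (\<Sum>z\<in>S. z ^ (1 + 2 ^ e)) = 0 \<longleftrightarrow>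
    S = {x, y, x + \<omega> * (x + y), y + \<omega> * (x + y)}" (is "?P S \<longleftrightarrow> S = ?S")
proof -
  have u: "x + y \<noteq> 0" using xy by (simp add: char2_add_eq_0_iff[OF two])
  note dbl = char2_add_self[OF two]
  have dbl2: "a + (a + b) = b" for a b :: 'a
    by (simp add: dbl flip: add.assoc)
  show ?thesis
  proof
    assume S: "?P S"
    then have "finite S" using card_ge_0_finite by force
    then have "card (S - {x, y}) = 2"
      using S xy by (simp add: card_Diff_subset)
    then obtain z w where zw: "S - {x, y} = {z, w}" "z \<noteq> w"
      by (auto simp: card_2_iff)
    then have Seq: "S = {x, y, z, w}" and ne: "z \<noteq> x" "z \<noteq> y" "w \<noteq> x" "w \<noteq> y"
      using S by auto
    have "x + y + z + w = 0 \<and> x ^ (1 + 2 ^ e) + y ^ (1 + 2 ^ e) + z ^ (1 + 2 ^ e) + w ^ (1 + 2 ^ e) = 0"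
      using S xy ne zw(2) unfolding Seq by (auto simp: add.assoc)
    then have w: "w = x + y + z" and eq: "(x + z) ^ 2 ^ e * (x + y) = (x + z) * (x + y) ^ 2 ^ e"
      by (simp_all only: quadruple_sums_eq_0_iff[OF two])
    \<comment> \<open>The affine coordinate of \<open>z\<close> in which \<open>x\<close> is 0 and
      \<open>y\<close> is 1; dividing the equation by powers of x + y shows that \<open>s\<close> is
      fixed.\<close>
    define s where "s = (x + z) / (x + y)"
    have "s ^ 2 ^ e = s"
      using eq u by (simp add: s_def power_divide field_simps)
    moreover have xz: "x + z = s * (x + y)" using u by (simp add: s_def)
    then have z: "z = x + s * (x + y)" by (metis dbl2)
    moreover have "s \<noteq> 0" "s \<noteq> 1"
      using z ne by (auto simp: dbl2)
    ultimately have "s = \<omega> \<or> s = \<omega> + 1"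
      using fixed by blast
    then show "S = ?S"
    proof
      assume "s = \<omega>"
      then show ?thesis using Seq w z by (simp add: ac_simps dbl2)
    next
      assume "s = \<omega> + 1"
      then have "z = y + \<omega> * (x + y)" using z by (simp add: algebra_simps dbl2)
      moreover from this have "w = x + \<omega> * (x + y)" using w by (simp add: ac_simps dbl2)
      ultimately show ?thesis using Seq by auto
    qed
  next
    assume S: "S = ?S"
    let ?z = "x + \<omega> * (x + y)" and ?w = "y + \<omega> * (x + y)"
    have ne: "?z \<noteq> x" "?w \<noteq> y" "?z \<noteq> ?w"
      using \<omega> u xy by auto
    have ne2: "?z \<noteq> y" "?w \<noteq> x"
    proof -
      have "\<omega> * (x + y) \<noteq> x + y" using \<omega> u by simp
      then show "?z \<noteq> y" "?w \<noteq> x" by (metis dbl2 add.commute)+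
    qed
    have "?w = x + y + ?z"
      by (simp add: ac_simps dbl2)
    moreover have "\<omega> ^ 2 ^ e = \<omega>" using fixed by blast
    then have "(x + ?z) ^ 2 ^ e * (x + y) = (x + ?z) * (x + y) ^ 2 ^ e"
      unfolding dbl2 by (simp add: power_mult_distrib)
    ultimately have "x + y + ?z + ?w = 0 \<and> x ^ (1 + 2 ^ e) + y ^ (1 + 2 ^ e) + ?z ^ (1 + 2 ^ e) + ?w ^ (1 + 2 ^ e) = 0"
      using quadruple_sums_eq_0_iff[OF two] by blast
    then show "?P S"
      unfolding S using xy ne ne2 by (auto simp: add.assoc)
  qed
qed

text \<open>The gcd hypothesis reduces the exponent 2^e to 4, and t^4 - t splits as t(t - 1)(t^2 + t
  + 1). A nontrivial cube root of unity and its translate by 1 are the roots of the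
  quadratic.\<close>

lemma fixed_points_power_2_power:
  fixes s \<omega> :: "'a::finite_field"
  assumes card: "CARD('a) = 2 ^ m" and "gcd m e = 2" and "m > 0" and e: "e \<noteq> 0"
    and \<omega>: "\<omega> \<noteq> 1" "\<omega> ^ 3 = 1"
  shows "s ^ 2 ^ e = s \<longleftrightarrow> s \<in> {0, 1, \<omega>, \<omega> + 1}"
proof -
  have two: "(2::'a) = 0" by (rule char2_of_card[OF card \<open>m > 0\<close>])
  have factor: "t ^ 4 = t \<longleftrightarrow> t = 0 \<or> t = 1 \<or> t\<^sup>2 + t + 1 = 0" for t :: 'a
  proof -
    have "t ^ 4 - t = t * ((t - 1) * (t\<^sup>2 + t + 1))"
      by (simp add: algebra_simps power2_eq_square power4_eq_xxxx)
    then show ?thesis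
      by (metis (no_types, lifting) eq_iff_diff_eq_0 mult_eq_0_iff)
  qed
  have "\<omega> ^ 4 = \<omega>"
    using \<omega>(2) by (simp add: eval_nat_numeral)
  moreover have "\<omega> \<noteq> 0" using \<omega>(2) by auto
  ultimately have om: "\<omega>\<^sup>2 + \<omega> + 1 = 0"
    using factor \<omega>(1) by blast
  have "t\<^sup>2 + t + 1 = 0 \<longleftrightarrow> t = \<omega> \<or> t = \<omega> + 1" for t :: 'a
  proof -
    \<comment> \<open>An integer identity: the second bracket is zero by \<open>om\<close> and the
      last term by characteristic 2.\<close>
    have "(t + \<omega>) * (t + (\<omega> + 1)) = (t\<^sup>2 + t + 1) + (\<omega>\<^sup>2 + \<omega> + 1) + 2 * (t * \<omega> - 1)"
      by (simp add: algebra_simps power2_eq_square)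
    then have "(t + \<omega>) * (t + (\<omega> + 1)) = t\<^sup>2 + t + 1"
      by (simp add: om two)
    then show ?thesis
      by (metis char2_add_eq_0_iff[OF two] mult_eq_0_iff)
  qed
  then have F4: "t ^ 4 = t \<longleftrightarrow> t \<in> {0, 1, \<omega>, \<omega> + 1}" for t :: 'a
    by (simp add: factor)
  have "s ^ 2 ^ e = s \<longleftrightarrow> s ^ 4 = s"
  proof
    assume "s ^ 2 ^ e = s"
    moreover have "s ^ 2 ^ m = s"
      using finite_field_power_card_eq_same[of s] card by simp
    ultimately show "s ^ 4 = s"
      using power_2_power_gcd_fixed[of s m e] assms(2) e by simp
  next
    assume "s ^ 4 = s"
    then have "s ^ 2 ^ 2 = s" by simp
    moreover obtain a where "e = a * 2"
      using assms(2) by (metis dvd_def gcd_dvd2 mult.commute)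
    ultimately show "s ^ 2 ^ e = s"
      using power_2_power_mult_fixed by metis
  qed
  then show ?thesis by (simp add: F4)
qed

section \<open>Indexing the field by powers of the generator, and the design\<close>

lemma bij_betw_powers_generator:
  fixes \<alpha> :: "'a::finite_field"
  assumes "\<alpha> \<noteq> 0" and gen: "\<forall>x. x \<noteq> 0 \<longrightarrow> (\<exists>k::int. x = \<alpha> powi k)"
    and n: "CARD('a) = Suc n" and "n > 0"
  shows "\<alpha> ^ n = 1"
    and "bij_betw (\<lambda>i. if i < n then \<alpha> ^ i else 0) {..n} (UNIV :: 'a set)"
proof -
  show 1: "\<alpha> ^ n = 1"
    using finite_field_power_card_eq_same[of \<alpha>] assms(1) n by simp
  let ?f = "\<lambda>i. if i < n then \<alpha> ^ i else (0::'a)"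
  have "x \<in> ?f ` {..n}" for x
  proof (cases "x = 0")
    case True
    then show ?thesis by (intro image_eqI[of _ _ n]) auto
  next
    case False
    then obtain k :: int where k: "x = \<alpha> powi k" using gen by blast
    \<comment> \<open>Because \<open>\<alpha> ^ n = 1\<close>, a possibly negative exponent may be
      replaced by its residue in the range below \<open>n\<close>.\<close>
    define j where "j = nat (k mod int n)"
    have j: "int j = k mod int n" "j < n"
      using \<open>n > 0\<close> by (simp_all add: j_def nat_less_iff)
    have "x = \<alpha> powi (int n * (k div int n) + int j)"
      by (simp add: k j)
    also have "\<dots> = (\<alpha> powi int n) powi (k div int n) * \<alpha> ^ j"
      using assms(1) by (simp add: power_int_add power_int_mult)
    also have "\<dots> = \<alpha> ^ j" by (simp add: 1)
    finally show ?thesis using j by (intro image_eqI[of _ _ j]) auto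
  qed
  then have "?f ` {..n} = UNIV" by auto
  \<comment> \<open>Counting: the n + 1 indices cover a field with n + 1 elements.\<close>
  moreover from this have "inj_on ?f {..n}"
    using n by (intro eq_card_imp_inj_on) simp_all
  ultimately show "bij_betw ?f {..n} UNIV"
    by (simp add: bij_betw_def)
qed

theorem theorem3p7:
  fixes m e :: nat and \<alpha> :: "'a::finite_field"
  assumes "m > 0" and "m mod 4 = 0"
    and "2 \<le> e" and "e \<le> m div 2" and "gcd m e = 2"
    and "CARD('a) = 2 ^ m"
    and "\<alpha> \<noteq> 0" and "\<forall>x. x \<noteq> 0 \<longrightarrow> (\<exists>k::int. x = \<alpha> powi k)"
  shows "two_design {0..2 ^ m - 1}
           {support c | c.
              c \<in> extended_code (cyclic_code (2 ^ m - 1)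
                    (lcm (min_poly_bit \<alpha>) (min_poly_bit (\<alpha> ^ (1 + 2 ^ e))))) \<and>
              hamming_weight c = 4}
           (2 ^ m) 4 1"
proof -
  define n :: nat where "n = 2 ^ m - 1"
  define q :: nat where "q = 1 + 2 ^ e"
  define pt where "pt = (\<lambda>i. if i < n then \<alpha> ^ i else 0)"
  have Suc_n: "2 ^ m = Suc n" by (simp add: n_def)
  have n: "n > 0" using one_less_power[of "2::nat" m] assms(1) by (simp add: n_def)
  have two: "(2::'a) = 0" by (rule char2_of_card[OF assms(6,1)])
  have ord: "\<alpha> ^ n = 1" and bij: "bij_betw pt {..n} UNIV"
    using bij_betw_powers_generator[OF assms(7,8) _ n] assms(6) Suc_n by (auto simp: pt_def)
  have inj: "inj_on pt {..n}" using bij by (rule bij_betw_imp_inj_on)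
  define \<B> where "\<B> = {B. B \<subseteq> {..n} \<and> card B = 4 \<and> (\<Sum>i\<in>B. pt i) = 0 \<and> (\<Sum>i\<in>B. pt i ^ q) = 0}"
  have blocks: "{support c | c. c \<in> extended_code (cyclic_code n
      (lcm (min_poly_bit \<alpha>) (min_poly_bit (\<alpha> ^ q)))) \<and> hamming_weight c = 4} = \<B>"
    unfolding \<B>_def pt_def
    by (rule weight_4_supports_extended_cyclic_code[OF two n ord]) (simp add: q_def)
  \<comment> \<open>As \<open>m\<close> is even, 3 divides n = 2^m - 1, and \<omega> is \<alpha>
    raised to n/3. It differs from 1 because \<open>pt\<close> separates the exponents
    \<open>d\<close> and 0.\<close>
  obtain \<omega> :: 'a where \<omega>: "\<omega> \<noteq> 1" "\<omega> ^ 3 = 1"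
  proof -
    have "even m" using assms(2) by presburger
    then obtain r where r: "m = 2 * r" by blast
    have "4 ^ r mod 3 = (1::nat)"
      using power_mod[of "4::nat" 3 r] by simp
    then have "n mod 3 = 0"
      by (simp add: n_def r power_mult) presburger
    then have "3 dvd n" by presburger
    then obtain d where d: "n = d * 3" by (metis dvd_def mult.commute)
    have "(\<alpha> ^ d) ^ 3 = 1" using ord by (simp add: d power_mult)
    moreover have "d < n" "0 < d" using d n by auto
    then have "\<alpha> ^ d \<noteq> 1"
      using inj_onD[OF inj, of d 0] n by (auto simp: pt_def)
    ultimately show thesis using that by blast
  qed
  have fixed: "s ^ 2 ^ e = s \<longleftrightarrow> s \<in> {0, 1, \<omega>, \<omega> + 1}" for s
    using fixed_points_power_2_power[OF assms(6,5,1) _ \<omega>] assms(3) by simp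
  have "\<omega> \<noteq> 0" using \<omega> by auto
  have "card {B \<in> \<B>. P \<subseteq> B} = 1" if P: "P \<subseteq> {..n}" "card P = 2" for P
  proof -
    obtain i j where ij: "P = {i, j}" "i \<noteq> j" using P(2) by (auto simp: card_2_iff)
    have ne: "pt i \<noteq> pt j" using P(1) ij inj by (auto dest: inj_onD)
    define x y where "x = pt i" and "y = pt j"
    define S where "S = {x, y, x + \<omega> * (x + y), y + \<omega> * (x + y)}"
    \<comment> \<open>Injectivity of \<open>pt\<close> carries cardinality and both sums over to the
      image, where \<open>unique_block\<close> applies.\<close>
    have key: "B \<in> \<B> \<and> P \<subseteq> B \<longleftrightarrow> pt ` B = S" if B: "B \<subseteq> {..n}" for B
    proof -
      have injB: "inj_on pt B" using inj B by (rule inj_on_subset)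
      have "B \<in> \<B> \<longleftrightarrow> card (pt ` B) = 4 \<and> (\<Sum>z\<in>pt ` B. z) = 0 \<and> (\<Sum>z\<in>pt ` B. z ^ q) = 0"
        using B injB by (simp add: \<B>_def card_image sum.reindex)
      moreover have "P \<subseteq> B \<longleftrightarrow> {x, y} \<subseteq> pt ` B"
        using inj_on_image_mem_iff[OF inj _ B] P(1) by (auto simp: ij x_def y_def)
      ultimately show ?thesis
        using unique_block[OF two _ fixed \<open>\<omega> \<noteq> 0\<close> \<omega>(1), of x y "pt ` B"] ne
        unfolding S_def x_def y_def q_def by blast
    qed
    \<comment> \<open>The preimage of \<open>S\<close>: surjectivity of \<open>pt\<close> makes its
      image all of \<open>S\<close>, and injectivity makes it the only such index set.\<close>
    define B0 where "B0 = {i \<in> {..n}. pt i \<in> S}"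
    have "pt ` {..n} = UNIV" using bij by (rule bij_betw_imp_surj_on)
    then have "\<exists>i\<in>{..n}. pt i = z" for z
      by (metis UNIV_I imageE)
    then have B0: "pt ` B0 = S"
      by (auto simp: B0_def image_iff) (metis atMost_iff)
    have "{B \<in> \<B>. P \<subseteq> B} = {B0}"
    proof (intro equalityI subsetI)
      fix B assume "B \<in> {B \<in> \<B>. P \<subseteq> B}"
      moreover from this have "B \<subseteq> {..n}" by (simp add: \<B>_def)
      ultimately have "B \<subseteq> {..n}" "pt ` B = S" using key by blast+
      then show "B \<in> {B0}"
        using inj_on_image_eq_iff[OF inj, of B B0] B0 by (auto simp: B0_def)
    next
      fix B assume "B \<in> {B0}"
      moreover have "B0 \<subseteq> {..n}" by (auto simp: B0_def)
      ultimately show "B \<in> {B \<in> \<B>. P \<subseteq> B}" using key B0 by blast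
    qed
    then show ?thesis by simp
  qed
  then have "two_design {0..n} \<B> (2 ^ m) 4 1"
    unfolding two_design_def by (auto simp: Suc_n \<B>_def atLeast0AtMost)
  then show ?thesis
    using blocks by (simp add: n_def q_def)
qed

end
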